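(* Let $n\ge3$ and let $(\mathfrak{r}_{2n+1}(2n-3),\cdot,[-,-])$ be a non-trivial transposed Poisson algebra structure on the Lie algebra $\mathfrak{r}_{2n+1}(2n-3)$. Then, up to isomorphism, the multiplication $\cdot$ has one of the following forms, for some complex numbers $\alpha,\beta$, where products of basis elements that are not listed (up to commutativity) are zero: $\mathbf{TP}_1$: $x\cdot x=e_{2n}$; $\mathbf{TP}_2$: $e_2\cdot x=e_{2n}$, $x\cdot x=(3-2n)e_{2n-1}$; $\mathbf{TP}_3$: $e_2\cdot x=e_{2n}$, $x\cdot x=(3-2n)e_{2n-1}+e_{2n}$; $\mathbf{TP}_4$: $e_2\cdot e_2=e_{2n}$, $e_2\cdot x=(3-2n)e_{2n-1}$; $\mathbf{TP}_5$: $e_2\cdot e_2=e_{2n}$, $e_2\cdot x=(3-2n)e_{2n-1}$, $x\cdot x=e_{2n}$; $\mathbf{TP}_6$: $e_2\cdot e_2=e_{2n}$, $e_2\cdot x=(3-2n)e_{2n-1}+e_{2n}$, $x\cdot x=(3-2n)e_{2n-1}+\alpha e_{2n}$; $\mathbf{TP}_7$: $e_2\cdot e_2=e_{2n-1}$; $\mathbf{TP}_8$: $e_2\cdot e_2=e_{2n-1}$, $x\cdot x=e_{2n}$; $\mathbf{TP}_9$: $e_2\cdot e_2=e_{2n-1}$, $e_2\cdot x=e_{2n}$, $x\cdot x=(3-2n)e_{2n-1}+\alpha e_{2n}$; $\mathbf{TP}_{10}$: $e_2\cdot e_2=e_{2n-1}+e_{2n}$, $e_2\cdot x=(3-2n)e_{2n-1}+\alpha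 e_{2n}$, $x\cdot x=(3-2n)\alpha e_{2n-1}+\beta e_{2n}$.
   Context: All algebras are over $\mathbb{C}$. A transposed Poisson algebra is a vector space $\mathfrak{L}$ with bilinear operations $\cdot$ and $[-,-]$ such that $(\mathfrak{L},\cdot)$ is a commutative associative algebra, $(\mathfrak{L},[-,-])$ is a Lie algebra, and $2z\cdot[u,v]=[z\cdot u,v]+[u,z\cdot v]$ for all $u,v,z\in\mathfrak{L}$. A transposed Poisson structure on a Lie algebra $(\mathfrak{L},[-,-])$ is an operation $\cdot$ making $(\mathfrak{L},\cdot,[-,-])$ a transposed Poisson algebra; it is trivial if $u\cdot v=0$ for all $u,v$. An isomorphism of transposed Poisson algebras is a linear bijection preserving both operations (so two structures on the same Lie algebra are isomorphic iff some Lie algebra automorphism carries one product to the other). $\mathfrak{r}_{2n+1}(\lambda)$ (here with $\lambda=2n-3$) is the $(2n+1)$-dimensional Lie algebra with basis $e_1,\dots,e_{2n},x$ and brackets $[e_i,e_1]=e_{i+1}$ for $2\le i\le 2n-2$; $[e_i,e_{2n+1-i}]=(-1)^ie_{2n}$ for $2\le i\le n$; $[e_1,x]=e_1$; $[e_i,x]=(i-2+\lambda)e_i$ for $2\le i\le 2n-1$; $[e_{2n},x]=(2n-3+2\lambda)e_{2n}$; brackets of basis elements not determined by these and antisymmetry are zero. *)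

theory Defs
  imports Complex_Main
begin

locale lie_algebra = vector_space scale
  for scale :: "complex \<Rightarrow> 'a::ab_group_add \<Rightarrow> 'a" +
  fixes bracket :: "'a \<Rightarrow> 'a \<Rightarrow> 'a"
  assumes bracket_linear_left: "Vector_Spaces.linear scale scale (\<lambda>u. bracket u v)"
    and bracket_linear_right: "Vector_Spaces.linear scale scale (\<lambda>v. bracket u v)"
    and bracket_alternating: "bracket u u = 0"
    and jacobi: "bracket u (bracket v w) + bracket v (bracket w u) + bracket w (bracket u v) = 0"

locale transposed_poisson_algebra = lie_algebra scale bracket
  for scale :: "complex \<Rightarrow> 'a::ab_group_add \<Rightarrow> 'a" and bracket :: "'a \<Rightarrow> 'a \<Rightarrow> 'a" +
  fixes mult :: "'a \<Rightarrow> 'a \<Rightarrow> 'a"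
  assumes mult_linear_left: "Vector_Spaces.linear scale scale (\<lambda>u. mult u v)"
    and mult_linear_right: "Vector_Spaces.linear scale scale (\<lambda>v. mult u v)"
    and mult_commute: "mult u v = mult v u"
    and mult_assoc: "mult (mult u v) w = mult u (mult v w)"
    and transposed_leibniz:
      "scale 2 (mult z (bracket u v)) = bracket (mult z u) v + bracket u (mult z v)"

definition trivial_product :: "('a::zero \<Rightarrow> 'a \<Rightarrow> 'a) \<Rightarrow> bool" where
  "trivial_product mult \<longleftrightarrow> (\<forall>u v. mult u v = 0)"

definition tp_isomorphism ::
  "(complex \<Rightarrow> 'a::ab_group_add \<Rightarrow> 'a) \<Rightarrow> ('a \<Rightarrow> 'a \<Rightarrow> 'a) \<Rightarrow> ('a \<Rightarrow> 'a \<Rightarrow> 'a) \<Rightarrow>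
   (complex \<Rightarrow> 'b::ab_group_add \<Rightarrow> 'b) \<Rightarrow> ('b \<Rightarrow> 'b \<Rightarrow> 'b) \<Rightarrow> ('b \<Rightarrow> 'b \<Rightarrow> 'b) \<Rightarrow>
   ('a \<Rightarrow> 'b) \<Rightarrow> bool" where
  "tp_isomorphism scale bracket mult scale' bracket' mult' f \<longleftrightarrow>
     Vector_Spaces.linear scale scale' f \<and> bij f \<and>
     (\<forall>u v. f (bracket u v) = bracket' (f u) (f v)) \<and>
     (\<forall>u v. f (mult u v) = mult' (f u) (f v))"

definition tp_isomorphic ::
  "(complex \<Rightarrow> 'a::ab_group_add \<Rightarrow> 'a) \<Rightarrow> ('a \<Rightarrow> 'a \<Rightarrow> 'a) \<Rightarrow> ('a \<Rightarrow> 'a \<Rightarrow> 'a) \<Rightarrow>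
   (complex \<Rightarrow> 'b::ab_group_add \<Rightarrow> 'b) \<Rightarrow> ('b \<Rightarrow> 'b \<Rightarrow> 'b) \<Rightarrow> ('b \<Rightarrow> 'b \<Rightarrow> 'b) \<Rightarrow> bool" where
  "tp_isomorphic scale bracket mult scale' bracket' mult' \<longleftrightarrow>
     (\<exists>f. tp_isomorphism scale bracket mult scale' bracket' mult' f)"

(* The whole type 'a is the Lie algebra r_{2n+1}(l), with basis e 1, ..., e (2n), x; the values
   of e outside {1..2n} are irrelevant. The brackets of basis elements not mentioned follow from
   bracket_alternating (and bilinearity). *)
locale r_lie_algebra = lie_algebra scale bracket
  for scale :: "complex \<Rightarrow> 'a::ab_group_add \<Rightarrow> 'a" and bracket :: "'a \<Rightarrow> 'a \<Rightarrow> 'a" +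
  fixes n :: nat and l :: complex and e :: "nat \<Rightarrow> 'a" and x :: 'a
  assumes basis_inj: "inj_on e {1..2*n}" "x \<notin> e ` {1..2*n}"
    and basis_independent: "independent (insert x (e ` {1..2*n}))"
    and basis_span: "span (insert x (e ` {1..2*n})) = UNIV"
    and bracket_e_e1: "\<lbrakk>2 \<le> i; i \<le> 2*n - 2\<rbrakk> \<Longrightarrow> bracket (e i) (e 1) = e (i + 1)"
    and bracket_e_e: "\<lbrakk>2 \<le> i; i \<le> n\<rbrakk> \<Longrightarrow>
          bracket (e i) (e (2*n + 1 - i)) = scale ((-1) ^ i) (e (2*n))"
    and bracket_e1_x: "bracket (e 1) x = e 1"
    and bracket_e_x: "\<lbrakk>2 \<le> i; i \<le> 2*n - 1\<rbrakk> \<Longrightarrow>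
          bracket (e i) x = scale (of_nat i - 2 + l) (e i)"
    and bracket_last_x: "bracket (e (2*n)) x = scale (2 * of_nat n - 3 + 2 * l) (e (2*n))"
    and bracket_e_e1_zero: "\<lbrakk>2*n - 1 \<le> i; i \<le> 2*n\<rbrakk> \<Longrightarrow> bracket (e i) (e 1) = 0"
    and bracket_e_e_zero: "\<lbrakk>2 \<le> i; i \<le> 2*n; 2 \<le> j; j \<le> 2*n; i + j \<noteq> 2*n + 1\<rbrakk> \<Longrightarrow>
          bracket (e i) (e j) = 0"

definition product_table ::
  "nat \<Rightarrow> (nat \<Rightarrow> 'a::zero) \<Rightarrow> 'a \<Rightarrow> ('a \<Rightarrow> 'a \<Rightarrow> 'a) \<Rightarrow> 'a \<Rightarrow> 'a \<Rightarrow> 'a \<Rightarrow> bool" where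
  "product_table n e x mult a b c \<longleftrightarrow>
     mult (e 2) (e 2) = a \<and> mult (e 2) x = b \<and> mult x (e 2) = b \<and> mult x x = c \<and>
     (\<forall>i\<in>{1..2*n}. \<forall>j\<in>{1..2*n}. (i, j) \<noteq> (2, 2) \<longrightarrow> mult (e i) (e j) = 0) \<and>
     (\<forall>i\<in>{1..2*n}. i \<noteq> 2 \<longrightarrow> mult (e i) x = 0 \<and> mult x (e i) = 0)"

end

theory Submission
  imports Defs
begin

text \<open>Put \<open>l = 2n - 3\<close>. By the transposed Leibniz rule every multiplication operator \<open>\<phi>\<close> is a
  half derivation: \<open>2 \<phi> [u, v] = [\<phi> u, v] + [u, \<phi> v]\<close>. The eigenvalues \<open>w i\<close> of \<open>u \<mapsto> [u, x]\<close> are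
  \<open>1, l, l + 1, ..., 2l, 3l\<close>, and the rule for \<open>[e i, x]\<close> determines the coefficient of \<open>e j\<close> in
  \<open>\<phi> (e i)\<close> from \<open>\<phi> x\<close> unless \<open>2 w i = w j\<close>, which happens only for \<open>i = 2\<close>, \<open>j = 2n - 1\<close>. The
  rule for \<open>[e i, e 1]\<close> then forces \<open>\<phi> x\<close> into the span of \<open>e (2n - 1)\<close> and \<open>e (2n)\<close>, up to adding a
  multiple of the identity to \<open>\<phi>\<close>. By commutativity no such multiple occurs, and the product is
  \<open>e 2 \<cdot> e 2 = A e (2n - 1) + B e (2n)\<close>, \<open>e 2 \<cdot> x = - l B e (2n - 1) + C e (2n)\<close>,
  \<open>x \<cdot> x = - l C e (2n - 1) + G e (2n)\<close>. A two-dimensional torus and the unipotent automorphisms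
  \<open>exp (c ad (e 2))\<close> bring \<open>(A, B, C, G)\<close> to one of the forms 1, 2, 4, 5, 7, 8, 9 of the list, so
  that the forms 3, 6 and 10 are redundant.\<close>

section \<open>Bilinearity, and transport of structures along automorphisms\<close>

lemma (in lie_algebra) linear_map_simps:
  assumes "Vector_Spaces.linear scale scale f"
  shows "f (u + v) = f u + f v" "f (scale c u) = scale c (f u)" "f 0 = 0"
proof -
  interpret f: module_hom scale scale f
    using assms by (simp add: Vector_Spaces.linear_def)
  show "f (u + v) = f u + f v" "f (scale c u) = scale c (f u)" "f 0 = 0"
    by (simp_all add: f.add f.scale f.zero)
qed

lemma (in lie_algebra) bracket_add_left: "bracket (u + v) w = bracket u w + bracket v w"
  and bracket_scale_left: "bracket (scale c u) v = scale c (bracket u v)"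
  using linear_map_simps[OF bracket_linear_left] by auto

lemma (in lie_algebra) bracket_add_right: "bracket w (u + v) = bracket w u + bracket w v"
  and bracket_scale_right: "bracket u (scale c v) = scale c (bracket u v)"
  using linear_map_simps[OF bracket_linear_right] by auto

lemma (in lie_algebra) bracket_zero_left [simp]: "bracket 0 v = 0"
  using bracket_add_left[of 0 0 v] by simp

lemma (in lie_algebra) bracket_zero_right [simp]: "bracket v 0 = 0"
  using bracket_add_right[of v 0 0] by simp

lemma (in lie_algebra) bracket_antisym: "bracket u v = - bracket v u"
proof -
  have "bracket (u + v) (u + v) = 0" by (rule bracket_alternating)
  then have "bracket u v + bracket v u = 0"
    unfolding bracket_add_left bracket_add_right by (simp add: bracket_alternating add.commute)
  then show ?thesis by (simp add: eq_neg_iff_add_eq_0)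
qed

lemma (in lie_algebra) bracket_derivation:
  "bracket a (bracket u v) = bracket (bracket a u) v + bracket u (bracket a v)"
proof -
  have "bracket u (bracket v a) = - bracket u (bracket a v)"
    using bracket_antisym[of v a] bracket_scale_right[of u "-1" "bracket a v"] by simp
  moreover have "bracket v (bracket a u) = - bracket (bracket a u) v"
    by (rule bracket_antisym)
  ultimately show ?thesis
    using jacobi[of a u v] by (simp add: diff_eq_eq)
qed

lemma (in lie_algebra) linear_mapI:
  assumes "\<And>u v. f (u + v) = f u + f v" "\<And>c u. f (scale c u) = scale c (f u)"
  shows "Vector_Spaces.linear scale scale f"
  using assms by (unfold_locales) auto

lemma (in transposed_poisson_algebra) mult_simps:
  "mult (u + v) w = mult u w + mult v w" "mult (scale c u) w = scale c (mult u w)" "mult 0 w = 0"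
  "mult w (u + v) = mult w u + mult w v" "mult w (scale c u) = scale c (mult w u)" "mult w 0 = 0"
  using linear_map_simps[OF mult_linear_left[of w]] linear_map_simps[OF mult_linear_right[of w]]
  by auto

text \<open>The new product is the pullback of \<open>m\<close> along \<open>g\<close>, and
  \<open>inv g\<close> is the isomorphism from the old structure to the new one. The last conclusion
  is phrased without \<open>inv g\<close>, so that parameters can later be compared by applying
  \<open>g\<close> alone.\<close>

lemma (in lie_algebra) transport_structure:
  assumes tp: "transposed_poisson_algebra scale bracket m"
    and lin: "Vector_Spaces.linear scale scale g" and bij: "bij g"
    and hom: "\<And>u v. g (bracket u v) = bracket (g u) (g v)"
  obtains m' where "transposed_poisson_algebra scale bracket m'"
    and "tp_isomorphic scale bracket m scale bracket m'"
    and "\<And>u v. g (m' u v) = m (g u) (g v)"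
proof -
  interpret m: transposed_poisson_algebra scale bracket m by (rule tp)
  define m' where "m' u v = inv g (m (g u) (g v))" for u v
  note g = linear_map_simps[OF lin]
  have gi [simp]: "g (inv g u) = u" for u
    using bij by (simp add: bij_is_surj surj_f_inv_f)
  have ig [simp]: "inv g (g u) = u" for u
    using bij by (simp add: bij_is_inj)
  have eqI: "u = v" if "g u = g v" for u v
    using that bij by (metis ig)
  have ilin: "Vector_Spaces.linear scale scale (inv g)"
    by (rule linear_mapI; rule eqI; simp add: g)
  have gm: "g (m' u v) = m (g u) (g v)" for u v
    by (simp add: m'_def)
  have ihom: "inv g (bracket u v) = bracket (inv g u) (inv g v)" for u v
    by (rule eqI) (simp add: hom)
  have "transposed_poisson_algebra scale bracket m'"
  proof (intro transposed_poisson_algebra.intro transposed_poisson_algebra_axioms.intro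
      lie_algebra_axioms)
    fix u v w z
    show "Vector_Spaces.linear scale scale (\<lambda>u. m' u v)"
      by (rule linear_mapI; rule eqI; simp add: g gm m.mult_simps)
    show "Vector_Spaces.linear scale scale (\<lambda>v. m' u v)"
      by (rule linear_mapI; rule eqI; simp add: g gm m.mult_simps)
    show "m' u v = m' v u"
      unfolding m'_def by (subst m.mult_commute) (rule refl)
    show "m' (m' u v) w = m' u (m' v w)"
      by (rule eqI) (simp add: gm m.mult_assoc)
    show "scale 2 (m' z (bracket u v)) = bracket (m' z u) v + bracket u (m' z v)"
      by (rule eqI) (simp only: g gm hom m.transposed_leibniz)
  qed
  moreover have "tp_isomorphic scale bracket m scale bracket m'"
    unfolding tp_isomorphic_def tp_isomorphism_def
    using ilin ihom bij_imp_bij_inv[OF bij] by (intro exI[of _ "inv g"]) (simp add: m'_def)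
  ultimately show ?thesis using gm by (rule that)
qed

lemma tp_isomorphic_trans:
  assumes "tp_isomorphic s1 b1 m1 s2 b2 m2" "tp_isomorphic s2 b2 m2 s3 b3 m3"
  shows "tp_isomorphic s1 b1 m1 s3 b3 m3"
proof -
  from assms obtain f g where
    f: "tp_isomorphism s1 b1 m1 s2 b2 m2 f" and g: "tp_isomorphism s2 b2 m2 s3 b3 m3 g"
    by (auto simp: tp_isomorphic_def)
  have "tp_isomorphism s1 b1 m1 s3 b3 m3 (g \<circ> f)"
    using f g unfolding tp_isomorphism_def
    by (auto intro: bij_comp Vector_Spaces.linear_compose)
  then show ?thesis by (auto simp: tp_isomorphic_def)
qed

lemma complex_root_exists:
  fixes c :: complex
  assumes "c \<noteq> 0" "k > 0"
  obtains z where "z ^ k = c"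
  using card_nth_roots[OF assms] assms(2) 
  by (metis (mono_tags, lifting) card.empty empty_Collect_eq less_irrefl)

section \<open>Coordinates with respect to the basis\<close>

text \<open>The value of \<open>l\<close> is resonant: twice the eigenvalue \<open>l\<close> of
  \<open>e 2\<close> equals the eigenvalue \<open>2n - 3 + l\<close> of \<open>e (2n - 1)\<close>
  exactly when \<open>l = 2n - 3\<close>.\<close>

locale r_lie_algebra_resonant =
  r_lie_algebra scale bracket n "2 * of_nat n - 3" e x
  for scale :: "complex \<Rightarrow> 'a::ab_group_add \<Rightarrow> 'a" and bracket :: "'a \<Rightarrow> 'a \<Rightarrow> 'a"
    and n :: nat and e :: "nat \<Rightarrow> 'a" and x :: 'a +
  assumes n_ge_3: "n \<ge> 3"
begin

text \<open>Keeps \<open>e 1\<close> from being rewritten to \<open>e (Suc 0)\<close>, so that the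
  bracket rules still match.\<close>

declare One_nat_def [simp del]

(* index 0 stands for x, also in weight below *)
definition coord :: "nat \<Rightarrow> 'a \<Rightarrow> complex" where
  "coord i v = representation (insert x (e ` {1..2*n})) v (if i = 0 then x else e i)"

(* the eigenvalues of u \<mapsto> [u, x] *)
definition weight :: "nat \<Rightarrow> nat" where
  "weight i = (if i = 0 then 0 else if i = 1 then 1 else if i = 2*n then 6*n - 9 else i + 2*n - 5)"

lemma coord_add [simp]: "coord i (u + v) = coord i u + coord i v"
  unfolding coord_def
  by (subst representation_add[OF basis_independent]) (use basis_span in simp_all)

lemma coord_scale [simp]: "coord i (scale c v) = c * coord i v"
  unfolding coord_def
  by (subst representation_scale[OF basis_independent]) (use basis_span in simp_all)

lemma coord_zero [simp]: "coord i 0 = 0"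
  using coord_scale[of i 0 0] by simp

lemma coord_uminus [simp]: "coord i (- v) = - coord i v"
  using coord_add[of i v "- v"] by (simp add: eq_neg_iff_add_eq_0 add.commute)

lemma coord_x [simp]: "i \<le> 2*n \<Longrightarrow> coord i x = (if i = 0 then 1 else 0)"
proof -
  assume "i \<le> 2*n"
  then have "(if i = 0 then x else e i) = x \<longleftrightarrow> i = 0" using basis_inj(2) by auto
  then show ?thesis
    by (simp only: coord_def representation_basis[OF basis_independent insertI1])
qed

lemma coord_e [simp]:
  assumes "i \<le> 2*n" "1 \<le> j" "j \<le> 2*n"
  shows "coord i (e j) = (if i = j then 1 else 0)"
proof -
  have "(if i = 0 then x else e i) = e j \<longleftrightarrow> i = j"
    using basis_inj assms by (auto dest: inj_onD)
  moreover have "e j \<in> insert x (e ` {1..2*n})" using assms by simp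
  ultimately show ?thesis
    by (simp only: coord_def representation_basis[OF basis_independent])
qed

text \<open>\<open>e 1\<close> has a case of its own because it acts by the shift from
  \<open>e i\<close> to \<open>e (i + 1)\<close>, whereas the later \<open>e i\<close> only pair
  into \<open>e (2n)\<close> among themselves.\<close>

lemma basis_induct [case_names zero add scale x e1 e]:
  assumes zero: "P 0" and add: "\<And>u v. P u \<Longrightarrow> P v \<Longrightarrow> P (u + v)"
    and scale: "\<And>c u. P u \<Longrightarrow> P (scale c u)"
    and x: "P x" and e1: "P (e 1)" and e: "\<And>i. 2 \<le> i \<Longrightarrow> i \<le> 2*n \<Longrightarrow> P (e i)"
  shows "P v"
proof -
  have "P b" if "b \<in> insert x (e ` {1..2*n})" for b
  proof (cases "b = x")
    case False
    with that obtain i where i: "1 \<le> i" "i \<le> 2*n" "b = e i" by auto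
    show ?thesis
    proof (cases "i = 1")
      case False
      then show ?thesis using e[of i] i by simp
    qed (use i e1 in simp)
  qed (use x in simp)
  moreover have "v \<in> span (insert x (e ` {1..2*n}))" using basis_span by simp
  ultimately show ?thesis
    using zero add scale by (metis span_induct_alt)
qed

lemma coord_eqI:
  assumes "\<And>i. i \<le> 2*n \<Longrightarrow> coord i u = coord i v"
  shows "u = v"
proof -
  let ?B = "insert x (e ` {1..2*n})"
  have "representation ?B u b = representation ?B v b" for b
  proof (cases "b \<in> ?B")
    case True
    then consider "b = x" | i where "1 \<le> i" "i \<le> 2*n" "b = e i" by auto
    then show ?thesis
    proof cases
      case 1
      then show ?thesis using assms[of 0] by (simp add: coord_def)
    next
      case (2 i)
      then show ?thesis using assms[of i] by (simp add: coord_def)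
    qed
  next
    case False
    then show ?thesis by (metis representation_ne_zero)
  qed
  then have eq: "representation ?B u = representation ?B v" by (rule ext)
  have "(\<Sum>b | representation ?B w b \<noteq> 0. scale (representation ?B w b) b) = w" for w
    using sum_nonzero_representation_eq[OF basis_independent, of w] basis_span by simp
  from this[of u] this[of v] eq show ?thesis by metis
qed

section \<open>Brackets in coordinates\<close>

lemma bracket_e_x_weight: "\<lbrakk>1 \<le> i; i \<le> 2*n\<rbrakk> \<Longrightarrow> bracket (e i) x = scale (of_nat (weight i)) (e i)"
  using bracket_e1_x bracket_last_x bracket_e_x[of i] n_ge_3
  by (cases "i = 1"; cases "i = 2*n") (auto simp: weight_def of_nat_diff algebra_simps)

lemma bracket_e_e1_eq:
  "\<lbrakk>2 \<le> i; i \<le> 2*n\<rbrakk> \<Longrightarrow> bracket (e i) (e 1) = (if i \<le> 2*n - 2 then e (i + 1) else 0)"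
  using bracket_e_e1[of i] bracket_e_e1_zero[of i] n_ge_3 by auto

text \<open>The locale gives the sign only for \<open>i \<le> n\<close>. For larger \<open>i\<close>
  antisymmetry produces \<open>- (-1) ^ j\<close>, and this is \<open>(-1) ^ i\<close> because
  \<open>i + j\<close> is odd.\<close>

lemma bracket_e_e_eq:
  assumes "2 \<le> i" "i \<le> 2*n" "2 \<le> j" "j \<le> 2*n"
  shows "bracket (e i) (e j) = (if i + j = 2*n + 1 then scale ((-1) ^ i) (e (2*n)) else 0)"
proof (cases "i + j = 2*n + 1")
  case sum: True
  show ?thesis
  proof (cases "i \<le> n")
    case True
    moreover have "j = 2*n + 1 - i" using sum by simp
    ultimately show ?thesis using bracket_e_e[of i] assms sum by simp
  next
    case False
    have "i = 2*n + 1 - j" using sum by simp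
    then have "bracket (e j) (e i) = scale ((-1) ^ j) (e (2*n))"
      using bracket_e_e[of j] assms sum False by simp
    moreover have "(-1) ^ j = - ((-1) ^ i :: complex)"
      using sum by (cases "even i"; cases "even j") (auto, presburger+)
    ultimately show ?thesis using bracket_antisym[of "e i" "e j"] sum by simp
  qed
qed (use bracket_e_e_zero assms in auto)

lemma coord_bracket_x:
  assumes j: "j \<le> 2*n"
  shows "coord j (bracket v x) = of_nat (weight j) * coord j v"
proof (induction v rule: basis_induct)
  case x
  show ?case using j by (simp add: bracket_alternating weight_def)
next
  case e1
  show ?case using j n_ge_3 by (simp add: bracket_e1_x weight_def)
next
  case (e i)
  then show ?case using bracket_e_x_weight[of i] j by simp
qed (simp_all add: bracket_add_left bracket_scale_left distrib_left)

lemma coord_bracket_e1: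
  assumes j: "j \<le> 2*n"
  shows "coord j (bracket v (e 1)) =
     (if j = 1 then - coord 0 v else if 3 \<le> j \<and> j < 2*n then coord (j - 1) v else 0)"
proof (induction v rule: basis_induct)
  case x
  show ?case using j n_ge_3 bracket_antisym[of x "e 1"] bracket_e1_x by auto
next
  case e1
  show ?case using j n_ge_3 by (auto simp: bracket_alternating)
next
  case (e i)
  then show ?case using j n_ge_3 by (auto simp: bracket_e_e1_eq)
qed (simp_all add: bracket_add_left bracket_scale_left split del: if_split, auto)

text \<open>The summands come from \<open>x\<close>, from \<open>e 1\<close> and from the partner
  \<open>e (2n + 1 - i)\<close>. The guard \<open>j < 2*n\<close> stops the shift at
  \<open>e (2n - 1)\<close>; the guard \<open>i < 2*n\<close> excludes the false partner
  \<open>e 1\<close> of \<open>e (2n)\<close>.\<close>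

lemma coord_bracket_e:
  assumes j: "j \<le> 2*n" and i: "2 \<le> i" "i \<le> 2*n"
  shows "coord j (bracket (e i) v) =
     (if j = i then of_nat (weight i) * coord 0 v else 0) +
     (if j = i + 1 \<and> j < 2*n then coord 1 v else 0) +
     (if j = 2*n \<and> i < 2*n then (-1) ^ i * coord (2*n + 1 - i) v else 0)"
proof (induction v rule: basis_induct)
  case x
  show ?case using i j n_ge_3 bracket_e_x_weight[of i] by auto
next
  case e1
  show ?case using i j n_ge_3 by (auto simp: bracket_e_e1_eq)
next
  case (e k)
  have "i + k = 2*n + 1 \<longleftrightarrow> i < 2*n \<and> 2*n + 1 - i = k" using e i by auto
  then show ?case using e i j n_ge_3 by (simp add: bracket_e_e_eq)
next
  case (add u v)
  then show ?case by (simp add: bracket_add_right distrib_left split del: if_split)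
      (auto simp: distrib_left)
next
  case (scale c u)
  then show ?case by (simp add: bracket_scale_right distrib_left split del: if_split)
      (auto simp: distrib_left)
qed simp

section \<open>Half derivations\<close>

text \<open>The weight \<open>6n - 9\<close> of \<open>e (2n)\<close> is odd, hence not a double,
  and its own double exceeds every weight. Between the weights \<open>i + 2n - 5\<close> the
  equation reads \<open>j = 2i + 2n - 5\<close>, and \<open>j < 2n\<close> leaves only
  \<open>i = 2\<close>.\<close>

lemma weight_nonresonant:
  assumes "1 \<le> i" "i \<le> 2*n" "j \<le> 2*n" "(i, j) \<noteq> (2, 2*n - 1)"
  shows "2 * (of_nat (weight i) :: complex) \<noteq> of_nat (weight j)"
proof -
  have "2 * weight i \<noteq> weight j"
  proof (cases "j = 2*n")
    case True
    have "odd (6*n - 9)" using n_ge_3 by simp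
    moreover have "weight j = 6*n - 9" using True n_ge_3 by (simp add: weight_def)
    moreover have "even (2 * weight i)" by simp
    ultimately show ?thesis by metis
  next
    case False
    show ?thesis
    proof (cases "i = 2*n")
      case True
      then show ?thesis using False assms n_ge_3 unfolding weight_def by auto
    next
      case i: False
      show ?thesis
      proof (cases "i = 1 \<or> j = 0 \<or> j = 1")
        case True
        then show ?thesis using False i assms n_ge_3 unfolding weight_def by auto
      next
        case low: False
        then have "weight i = i + 2*n - 5" "weight j = j + 2*n - 5"
          using False i assms unfolding weight_def by simp_all
        then show ?thesis using False i low assms n_ge_3 by auto
      qed
    qed
  qed
  then have "(of_nat (2 * weight i) :: complex) \<noteq> of_nat (weight j)"
    unfolding of_nat_eq_iff .
  then show ?thesis by simp
qed

lemma of_nat_weight: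
  "\<lbrakk>2 \<le> i; i < 2*n\<rbrakk> \<Longrightarrow> (of_nat (weight i) :: complex) = of_nat i + 2 * of_nat n - 5"
  "(of_nat (weight (2*n)) :: complex) = 6 * of_nat n - 9"
  "weight 1 = 1" "weight 0 = 0"
  using n_ge_3 by (simp_all add: weight_def of_nat_diff)

lemma eq_last_two:
  assumes "\<And>j. j \<le> 2*n - 2 \<Longrightarrow> coord j v = 0"
  shows "v = scale (coord (2*n - 1) v) (e (2*n - 1)) + scale (coord (2*n) v) (e (2*n))"
proof (rule coord_eqI)
  fix j assume "j \<le> 2*n"
  then consider "j \<le> 2*n - 2" | "j = 2*n - 1" | "j = 2*n" by linarith
  then show "coord j v = coord j (scale (coord (2*n - 1) v) (e (2*n - 1)) +
      scale (coord (2*n) v) (e (2*n)))"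
  proof cases
    case 1
    then have "j \<noteq> 2*n - 1" "j \<noteq> 2*n" "j \<le> 2*n" using n_ge_3 by linarith+
    then show ?thesis using 1 n_ge_3 by (simp add: assms)
  next
    case 2
    then have "j \<noteq> 2*n" using n_ge_3 by linarith
    then show ?thesis using 2 n_ge_3 by simp
  next
    case 3
    then have "j \<noteq> 2*n - 1" using n_ge_3 by linarith
    then show ?thesis using 3 n_ge_3 by simp
  qed
qed

text \<open>The identity is a half derivation, and \<open>x0\<close> is the normalisation that
  removes its multiple. Three parameters survive: \<open>a\<close> is the resonant entry,
  \<open>b\<close> is tied to the \<open>e (2n - 1)\<close> coordinate of \<phi> x, and
  \<open>c\<close> is free because \<open>e (2n)\<close> commutes with every
  \<open>e i\<close>.\<close>

lemma half_derivation_x_zero: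
  assumes lin: "Vector_Spaces.linear scale scale \<phi>"
    and half: "\<And>u v. scale 2 (\<phi> (bracket u v)) = bracket (\<phi> u) v + bracket u (\<phi> v)"
    and x0: "coord 0 (\<phi> x) = 0"
  obtains a b c where "\<phi> x = scale (- (2 * of_nat n - 3) * b) (e (2*n - 1)) + scale c (e (2*n))"
    and "\<phi> (e 2) = scale a (e (2*n - 1)) + scale b (e (2*n))"
    and "\<And>i. 1 \<le> i \<Longrightarrow> i \<le> 2*n \<Longrightarrow> i \<noteq> 2 \<Longrightarrow> \<phi> (e i) = 0"
proof -
  define y where "y = \<phi> x"
  define K where "K i j = coord j (\<phi> (e i))" for i j
  note \<phi> = linear_map_simps[OF lin]
  \<comment> \<open>The rule at \<open>[e i, x]\<close> is an equation for the single matrix entry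
    \<open>K i j\<close>, with coefficient \<open>2 * weight i - weight j\<close>.\<close>
  have res: "2 * of_nat (weight i) * K i j = of_nat (weight j) * K i j + coord j (bracket (e i) y)"
    if "1 \<le> i" "i \<le> 2*n" "j \<le> 2*n" for i j
  proof -
    have "coord j (scale 2 (\<phi> (bracket (e i) x))) = coord j (bracket (\<phi> (e i)) x + bracket (e i) y)"
      unfolding y_def by (subst half) (rule refl)
    then show ?thesis
      using that by (simp add: bracket_e_x_weight \<phi> coord_bracket_x K_def)
  qed
  have rel: "2 * K (i + 1) j = coord j (bracket (\<phi> (e i)) (e 1)) + coord j (bracket (e i) (\<phi> (e 1)))"
    if "2 \<le> i" "i \<le> 2*n - 2" for i j
  proof -
    have "coord j (scale 2 (\<phi> (bracket (e i) (e 1)))) =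
        coord j (bracket (\<phi> (e i)) (e 1) + bracket (e i) (\<phi> (e 1)))"
      by (subst half) (rule refl)
    then show ?thesis using that by (simp add: bracket_e_e1 K_def)
  qed
  have y0: "coord 0 y = 0" using x0 by (simp add: y_def)
  have e1_y: "coord j (bracket (e 1) y) = (if 3 \<le> j \<and> j < 2*n then - coord (j - 1) y else 0)"
    if "j \<le> 2*n" for j
    using that y0 bracket_antisym[of "e 1" y] by (simp add: coord_bracket_e1)
  \<comment> \<open>The \<open>e 1\<close> coordinate of \<open>y\<close> drives both
    \<open>K 2 3\<close> and \<open>K 3 4\<close>, since \<open>e 1\<close> moves \<open>e 2\<close>
    to \<open>e 3\<close> and \<open>e 3\<close> to \<open>e 4\<close>. The relation
    \<open>C\<close> between these entries leaves \<open>(2n - 5) * K 3 4 = 0\<close>, and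
    \<open>2n - 5\<close> is odd.\<close>
  have y1: "coord 1 y = 0"
  proof -
    have A: "2 * of_nat (weight 2) * K 2 3 = of_nat (weight 3) * K 2 3 + coord 1 y"
      using res[of 2 3] n_ge_3 y0 by (simp add: coord_bracket_e)
    have B: "2 * of_nat (weight 3) * K 3 4 = of_nat (weight 4) * K 3 4 + coord 1 y"
      using res[of 3 4] n_ge_3 y0 by (simp add: coord_bracket_e)
    have C: "K 2 3 = 2 * K 3 4"
      using rel[of 2 4] n_ge_3 by (simp add: coord_bracket_e coord_bracket_e1 K_def)
    have A': "coord 1 y = (4 * of_nat n - 8) * K 3 4"
      using A n_ge_3 unfolding C by (simp add: of_nat_weight algebra_simps)
    have B': "coord 1 y = (2 * of_nat n - 3) * K 3 4"
      using B n_ge_3 by (simp add: of_nat_weight algebra_simps)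
    have "(2 * of_nat n - 5) * K 3 4 = 0" using A' unfolding B' by algebra
    moreover have "(2 * of_nat n - 5 :: complex) \<noteq> 0"
    proof -
      have "(of_nat (2 * n) :: complex) \<noteq> of_nat 5" unfolding of_nat_eq_iff by presburger
      then show ?thesis by simp
    qed
    ultimately show ?thesis using B' by simp
  qed
  \<comment> \<open>This coordinate of \<open>y\<close> enters \<open>[e 1, y]\<close> at
    \<open>e (i + 1)\<close> and \<open>[e (2n - i + 1), y]\<close> at \<open>e (2n)\<close>, which
    gives equations for \<open>E\<close> and \<open>F\<close>. The rule at
    \<open>[e (2n - i), e 1]\<close> links them by \<open>2 * F = s * E\<close>. On elimination
    \<open>i\<close> cancels and \<open>(6n - 11) * E = 0\<close> remains, with an odd
    factor.\<close>
  have yi: "coord i y = 0" if i: "2 \<le> i" "i \<le> 2*n - 2" for i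
  proof -
    have i': "i + 1 < 2*n" "1 \<le> i + 1" "2 \<le> 2*n - i + 1" "2*n - i + 1 < 2*n"
      "2*n + 1 - (2*n - i + 1) = i" "2 \<le> 2*n - i" "2*n - i \<le> 2*n - 2" "2*n - i < 2*n"
      "2*n + 1 - (2*n - i) = i + 1"
      using i by auto
    define s :: complex where "s = (-1) ^ i"
    have ss: "s * s = 1" by (simp add: s_def minus_one_power_iff)
    have sgn: "(-1) ^ (2*n - i) = s" "(-1) ^ (2*n - i + 1) = - s"
      using i by (auto simp: s_def minus_one_power_iff)
    define E where "E = K 1 (i + 1)"
    define F where "F = K (2*n - i + 1) (2*n)"
    have "2 * E = of_nat (weight (i + 1)) * E - coord i y"
      using res[of 1 "i + 1"] i i' e1_y[of "i + 1"] by (simp add: of_nat_weight E_def)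
    then have 1: "coord i y = (of_nat i + 2 * of_nat n - 6) * E"
      using i i' by (simp add: of_nat_weight algebra_simps)
    have "2 * of_nat (weight (2*n - i + 1)) * F = of_nat (weight (2*n)) * F - s * coord i y"
      using res[of "2*n - i + 1" "2*n"] i' sgn y0 y1 by (simp add: coord_bracket_e F_def)
    moreover have "(of_nat (weight (2*n - i + 1)) :: complex) = 4 * of_nat n - of_nat i - 4"
      using i i' by (simp add: of_nat_weight of_nat_diff)
    ultimately have 2: "(2 * of_nat n - 2 * of_nat i + 1) * F = - s * coord i y"
      by (simp only: of_nat_weight(2)) algebra
    have 3: "2 * F = s * E"
      using rel[of "2*n - i" "2*n"] i' sgn
      by (simp add: coord_bracket_e coord_bracket_e1 F_def E_def K_def)
    have "(6 * of_nat n - 11) * E = 0"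
      using 1 2 3 ss by algebra
    moreover have "(6 * of_nat n - 11 :: complex) \<noteq> 0"
    proof -
      have "(of_nat (6 * n) :: complex) \<noteq> of_nat 11" unfolding of_nat_eq_iff by presburger
      then show ?thesis by simp
    qed
    ultimately show ?thesis using 1 by simp
  qed
  have y_small: "coord i y = 0" if "i \<le> 2*n - 2" for i
    using that y0 y1 yi by (cases "i = 0"; cases "i = 1") auto
  \<comment> \<open>Now \<open>y\<close> lies in the span of \<open>e (2n - 1)\<close> and
    \<open>e (2n)\<close>. Among the \<open>e i\<close>, only \<open>e 2\<close> has a nonzero
    bracket with \<open>e (2n - 1)\<close>, and none has one with \<open>e (2n)\<close>.\<close>
  have e_y: "coord j (bracket (e i) y) = 0" if "1 \<le> i" "i \<le> 2*n" "j \<le> 2*n" "(i, j) \<noteq> (2, 2*n)" for i j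
  proof (cases "i = 1")
    case True
    moreover have "coord (j - 1) y = 0" if "j < 2*n"
      using that by (intro y_small) auto
    ultimately show ?thesis using that by (simp add: e1_y)
  next
    case False
    moreover have "coord (2*n + 1 - i) y = 0" if "i \<noteq> 2"
      using that False \<open>1 \<le> i\<close> by (intro y_small) auto
    moreover have "coord j (bracket (e i) y) =
        (if j = 2*n \<and> i < 2*n then (-1) ^ i * coord (2*n + 1 - i) y else 0)"
      using that False coord_bracket_e[of j i y] by (simp add: y0 y1)
    ultimately show ?thesis using that(4) by (cases "i = 2") simp_all
  qed
  have K0: "K i j = 0"
    if "1 \<le> i" "i \<le> 2*n" "j \<le> 2*n" "(i, j) \<noteq> (2, 2*n)" "(i, j) \<noteq> (2, 2*n - 1)" for i j
    using res[of i j] e_y[of i j] weight_nonresonant[of i j] that by auto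
  \<comment> \<open>The partner of \<open>e 2\<close> is \<open>e (2n - 1)\<close>. With weights
    \<open>l\<close> and \<open>3l\<close>, \<open>res\<close> at \<open>(2, 2n)\<close> reads
    \<open>2 l b = 3 l b + coord (2n - 1) y\<close>.\<close>
  have "2*n + 1 - 2 = 2*n - 1" by simp
  then have "2 * of_nat (weight 2) * K 2 (2*n) = of_nat (weight (2*n)) * K 2 (2*n) + coord (2*n - 1) y"
    using res[of 2 "2*n"] n_ge_3 y0 by (simp only: coord_bracket_e) simp
  moreover have "of_nat (weight 2) = (2 * of_nat n - 3 :: complex)"
    using n_ge_3 by (simp add: of_nat_weight)
  ultimately have b: "coord (2*n - 1) y = - (2 * of_nat n - 3) * K 2 (2*n)"
    unfolding of_nat_weight(2) by algebra
  show ?thesis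
  proof
    show "\<phi> x = scale (- (2 * of_nat n - 3) * K 2 (2*n)) (e (2*n - 1)) +
        scale (coord (2*n) y) (e (2*n))"
      unfolding y_def[symmetric] b[symmetric] by (rule eq_last_two) (rule y_small)
    show "\<phi> (e 2) = scale (K 2 (2*n - 1)) (e (2*n - 1)) + scale (K 2 (2*n)) (e (2*n))"
      unfolding K_def
    proof (rule eq_last_two)
      fix j assume "j \<le> 2*n - 2"
      then have "j \<le> 2*n" "j \<noteq> 2*n" "j \<noteq> 2*n - 1" using n_ge_3 by linarith+
      then show "coord j (\<phi> (e 2)) = 0" using K0[of 2 j] n_ge_3 by (simp add: K_def)
    qed
    show "\<phi> (e i) = 0" if "1 \<le> i" "i \<le> 2*n" "i \<noteq> 2" for i
    proof (rule coord_eqI)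
      fix j assume "j \<le> 2*n"
      then show "coord j (\<phi> (e i)) = coord j 0" using K0[of i j] that by (simp add: K_def)
    qed
  qed
qed

section \<open>The four-parameter family of products\<close>

lemma coord_last:
  "coord (2*n) (e (2*n)) = 1" "coord (2*n - 1) (e (2*n - 1)) = 1"
  "coord (2*n) (e (2*n - 1)) = 0" "coord (2*n - 1) (e (2*n)) = 0"
proof -
  have *: "2*n - 1 \<noteq> 2*n" "2*n \<noteq> 2*n - 1" "1 \<le> 2*n - 1" "1 \<le> 2*n" "2*n - 1 \<le> 2*n" "2*n \<le> 2*n"
    using n_ge_3 by linarith+
  show "coord (2*n) (e (2*n)) = 1" "coord (2*n - 1) (e (2*n - 1)) = 1"
    "coord (2*n) (e (2*n - 1)) = 0" "coord (2*n - 1) (e (2*n)) = 0"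
    by (simp_all only: coord_e * if_True if_False refl)
qed

lemma coord_last_two:
  "coord (2*n - 1) (scale a (e (2*n - 1)) + scale b (e (2*n))) = a"
  "coord (2*n) (scale a (e (2*n - 1)) + scale b (e (2*n))) = b"
  by (simp_all only: coord_add coord_scale coord_last mult_1_right mult_zero_right add_0_left add_0_right)

lemma last_two_eq_iff:
  "scale a (e (2*n - 1)) + scale b (e (2*n)) = scale c (e (2*n - 1)) + scale d (e (2*n)) \<longleftrightarrow>
    a = c \<and> b = d"
  by (metis coord_last_two)

text \<open>The repeated \<open>B\<close> and \<open>C\<close> reflect the constraint on
  \<open>b\<close> in \<open>half_derivation_x_zero\<close>, applied to multiplication by
  \<open>e 2\<close> and by \<open>x\<close> respectively.\<close>

definition parametrized :: "('a \<Rightarrow> 'a \<Rightarrow> 'a) \<Rightarrow> complex \<Rightarrow> complex \<Rightarrow> complex \<Rightarrow> complex \<Rightarrow> bool" where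
  "parametrized m A B C G \<longleftrightarrow> product_table n e x m
     (scale A (e (2*n - 1)) + scale B (e (2*n)))
     (scale (- (2 * of_nat n - 3) * B) (e (2*n - 1)) + scale C (e (2*n)))
     (scale (- (2 * of_nat n - 3) * C) (e (2*n - 1)) + scale G (e (2*n)))"

text \<open>Multiplication by \<open>z\<close> splits as \<psi> z plus the multiple
  \<open>s z\<close> of the identity, and \<psi> z falls under
  \<open>half_derivation_x_zero\<close>. Comparing products with \<open>e 1\<close> in both orders
  shows that \<open>s\<close> vanishes on the basis.\<close>

lemma parametrized_exists:
  assumes "transposed_poisson_algebra scale bracket m"
  obtains A B C G where "parametrized m A B C G"
proof -
  interpret m: transposed_poisson_algebra scale bracket m by (rule assms)
  define s where "s z = coord 0 (m z x)" for z
  define \<psi> where "\<psi> z u = m z u - scale (s z) u" for z u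
  have lin: "Vector_Spaces.linear scale scale (\<psi> z)" for z
    by (rule linear_mapI) (simp_all add: \<psi>_def m.mult_simps scale_right_distrib
      scale_right_diff_distrib mult.commute)
  have half: "scale 2 (\<psi> z (bracket u v)) = bracket (\<psi> z u) v + bracket u (\<psi> z v)" for z u v
  proof -
    have \<psi>': "\<psi> z u = m z u + scale (- s z) u" for u by (simp add: \<psi>_def)
    have "scale 2 w = w + w" for w using scale_left_distrib[of 1 1 w] by simp
    then show ?thesis
      unfolding \<psi>' scale_right_distrib m.transposed_leibniz
      by (simp only: bracket_add_left bracket_add_right bracket_scale_left bracket_scale_right
          add.assoc add.left_commute)
  qed
  have x0: "coord 0 (\<psi> z x) = 0" for z
    unfolding \<psi>_def s_def using coord_add[of 0 "m z x" "- scale (coord 0 (m z x)) x"] by simp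
  have \<psi>: "\<exists>a b c. \<psi> z x = scale (- (2 * of_nat n - 3) * b) (e (2*n - 1)) + scale c (e (2*n)) \<and>
      \<psi> z (e 2) = scale a (e (2*n - 1)) + scale b (e (2*n)) \<and>
      (\<forall>i. 1 \<le> i \<longrightarrow> i \<le> 2*n \<longrightarrow> i \<noteq> 2 \<longrightarrow> \<psi> z (e i) = 0)" for z
    by (rule half_derivation_x_zero[OF lin[of z] half x0]) blast
  have m_\<psi>: "m z u = \<psi> z u + scale (s z) u" for z u by (simp add: \<psi>_def)
  have \<psi>_e: "\<psi> z (e i) = 0" if "1 \<le> i" "i \<le> 2*n" "i \<noteq> 2" for z i
    using \<psi>[of z] that by blast
  \<comment> \<open>In one order the product of \<open>e 1\<close> and \<open>e 3\<close> is a
    multiple of \<open>e 3\<close>, in the other a multiple of \<open>e 1\<close>.\<close>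
  have s_e1: "s (e 1) = 0"
  proof -
    have "m (e 1) (e 3) = scale (s (e 1)) (e 3)" "m (e 3) (e 1) = scale (s (e 3)) (e 1)"
      using n_ge_3 by (simp_all add: m_\<psi> \<psi>_e)
    then have "coord 3 (scale (s (e 1)) (e 3)) = coord 3 (scale (s (e 3)) (e 1))"
      by (metis m.mult_commute)
    then show ?thesis using n_ge_3 by simp
  qed
  have \<psi>_low: "coord 1 (\<psi> z (e i)) = 0" "coord 1 (\<psi> z x) = 0" if "1 \<le> i" "i \<le> 2*n" for z i
  proof -
    have "2*n \<noteq> 1" "2*n - 1 \<noteq> 1" using n_ge_3 by linarith+
    then have low: "coord 1 (scale a (e (2*n - 1)) + scale b (e (2*n))) = 0" for a b
      using n_ge_3 by simp
    show "coord 1 (\<psi> z x) = 0" using \<psi>[of z] low by metis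
    have "coord 1 (\<psi> z (e 2)) = 0" using \<psi>[of z] low by metis
    then show "coord 1 (\<psi> z (e i)) = 0" using \<psi>_e[OF that] by (cases "i = 2") simp_all
  qed
  \<comment> \<open>As \<open>s (e 1) = 0\<close>, the two orders of the product of \<open>z\<close>
    and \<open>e 1\<close> give \<open>scale (s z) (e 1)\<close> and \<psi> (e 1) z. By the previous
    fact the latter has no \<open>e 1\<close> coordinate when \<open>z\<close> is a basis
    vector.\<close>
  have s_eq: "s z = coord 1 (\<psi> (e 1) z)" for z
  proof -
    have "m z (e 1) = scale (s z) (e 1)" using n_ge_3 by (simp add: m_\<psi> \<psi>_e)
    moreover have "m (e 1) z = \<psi> (e 1) z" by (simp add: m_\<psi> s_e1)
    ultimately have "\<psi> (e 1) z = scale (s z) (e 1)" by (metis m.mult_commute)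
    then show ?thesis using n_ge_3 by simp
  qed
  have s_e: "s (e i) = 0" if "1 \<le> i" "i \<le> 2*n" for i
    using \<psi>_low(1)[of i "e 1"] that by (simp add: s_eq)
  have s_x: "s x = 0" using \<psi>_low(2)[of 1 "e 1"] n_ge_3 by (simp add: s_eq)
  have m_e: "m (e i) u = \<psi> (e i) u" if "1 \<le> i" "i \<le> 2*n" for i u
    using that by (simp add: m_\<psi> s_e)
  have m_x: "m x u = \<psi> x u" for u by (simp add: m_\<psi> s_x)
  obtain a b c where e2: "m (e 2) x = scale (- (2 * of_nat n - 3) * b) (e (2*n - 1)) + scale c (e (2*n))"
      "m (e 2) (e 2) = scale a (e (2*n - 1)) + scale b (e (2*n))"
    using \<psi>[of "e 2"] m_e[of 2] n_ge_3 by auto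
  obtain a' b' c' where xx: "m x x = scale (- (2 * of_nat n - 3) * b') (e (2*n - 1)) + scale c' (e (2*n))"
      "m x (e 2) = scale a' (e (2*n - 1)) + scale b' (e (2*n))"
    using \<psi>[of x] m_x by metis
  \<comment> \<open>The product of \<open>e 2\<close> and \<open>x\<close> is seen by both half
    derivations; its \<open>e (2n)\<close> coordinate couples their parameters.\<close>
  have "b' = c" using xx(2) e2(1) m.mult_commute[of x "e 2"] last_two_eq_iff by simp
  moreover have "m (e i) (e j) = 0" if "i \<in> {1..2*n}" "j \<in> {1..2*n}" "(i, j) \<noteq> (2, 2)" for i j
  proof (cases "j = 2")
    case True
    then have "m (e j) (e i) = 0" using that by (simp add: m_e \<psi>_e)
    then show ?thesis by (metis m.mult_commute)
  qed (use that in \<open>simp add: m_e \<psi>_e\<close>)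
  moreover have "m x (e i) = 0 \<and> m (e i) x = 0" if "i \<in> {1..2*n}" "i \<noteq> 2" for i
    using that m.mult_commute[of x "e i"] by (simp add: m_x \<psi>_e)
  ultimately have "parametrized m a b c c'"
    unfolding parametrized_def product_table_def using e2 xx m.mult_commute[of x "e 2"] by simp
  then show ?thesis by (rule that)
qed

lemma trivial_if_parametrized_zero:
  assumes "transposed_poisson_algebra scale bracket m" "parametrized m 0 0 0 0"
  shows "trivial_product m"
proof -
  interpret m: transposed_poisson_algebra scale bracket m by (rule assms)
  note tab = assms(2)[unfolded parametrized_def product_table_def]
  have ee: "m (e i) (e j) = 0" if "1 \<le> i" "i \<le> 2*n" "1 \<le> j" "j \<le> 2*n" for i j
    using tab that by (cases "(i, j) = (2, 2)") simp_all
  have ex: "m (e i) x = 0" "m x (e i) = 0" if "1 \<le> i" "i \<le> 2*n" for i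
    using tab that by (cases "i = 2"; simp)+
  have xx: "m x x = 0" using tab by simp
  have mx: "m u x = 0" for u
    by (induction u rule: basis_induct) (use n_ge_3 in \<open>simp_all add: m.mult_simps ex xx\<close>)
  have me: "m u (e j) = 0" if "1 \<le> j" "j \<le> 2*n" for u j
    by (induction u rule: basis_induct) (use n_ge_3 that in \<open>simp_all add: m.mult_simps ex ee\<close>)
  have "m u v = 0" for u v
    by (induction v rule: basis_induct) (use n_ge_3 in \<open>simp_all add: m.mult_simps mx me\<close>)
  then show ?thesis by (simp add: trivial_product_def)
qed

section \<open>Action of automorphisms on the parameters\<close>

text \<open>Hiding the product behind an existential lets successive automorphisms be chained as
  changes of the parameters alone.\<close>

definition equivalent_structure ::
  "('a \<Rightarrow> 'a \<Rightarrow> 'a) \<Rightarrow> complex \<Rightarrow> complex \<Rightarrow> complex \<Rightarrow> complex \<Rightarrow> bool" where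
  "equivalent_structure m A B C G \<longleftrightarrow>
     (\<exists>m'. transposed_poisson_algebra scale bracket m' \<and>
       tp_isomorphic scale bracket m scale bracket m' \<and> parametrized m' A B C G)"

text \<open>The unipotent automorphism \<open>exp (c ad (e 2))\<close>; only the two leading terms of the
  exponential series survive because \<open>(ad (e 2))\<^sup>2 = 0\<close>.\<close>

lemma equivalent_structure_shift:
  fixes c :: complex
  assumes eq: "equivalent_structure m A B C G"
  defines "l \<equiv> 2 * of_nat n - 3"
  defines "C' \<equiv> C + c * l * (2 * B - c * A)"
  shows "equivalent_structure m A (B - c * A) C' (G + 2 * c * l * C + c\<^sup>2 * l\<^sup>2 * B + c * l * C')"
proof -
  from eq obtain m1 where m1: "transposed_poisson_algebra scale bracket m1"
      "tp_isomorphic scale bracket m scale bracket m1" "parametrized m1 A B C G"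
    by (auto simp: equivalent_structure_def)
  interpret m1: transposed_poisson_algebra scale bracket m1 by (rule m1)
  define D where "D = bracket (e 2)"
  have D_add: "D (u + v) = D u + D v" and D_scale: "D (scale a u) = scale a (D u)" for u v a
    by (simp_all add: D_def bracket_add_right bracket_scale_right)
  have D_diff: "D (u - v) = D u - D v" for u v
    using D_add[of "u - v" v] by (simp add: eq_diff_eq)
  have D_e: "D (e i) = (if i = 2*n - 1 then e (2*n) else 0)" if "2 \<le> i" "i \<le> 2*n" for i
    using that n_ge_3 by (auto simp: D_def bracket_e_e_eq)
  have D_x: "D x = scale l (e 2)"
    using n_ge_3 bracket_e_x[of 2] by (simp add: D_def l_def)
  have D_e1: "D (e 1) = e 3" using n_ge_3 bracket_e_e1[of 2] by (simp add: D_def)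
  have DD: "D (D u) = 0" for u
  proof (induction u rule: basis_induct)
    case zero
    show ?case by (simp add: D_def)
  next
    case (e i)
    have "2*n \<noteq> 2*n - 1" using n_ge_3 by linarith
    then show ?case using e D_e[of i] D_e[of "2*n"] n_ge_3 by (simp add: D_def)
  next
    case x
    have "2 \<noteq> 2*n - 1" "2 \<le> 2*n" using n_ge_3 by linarith+
    then show ?case using D_e[of 2] by (simp add: D_scale D_x)
  next
    case e1
    have "3 \<noteq> 2*n - 1" "3 \<le> 2*n" using n_ge_3 by linarith+
    then show ?case using D_e[of 3] by (simp add: D_e1)
  qed (simp_all add: D_add D_scale)
  have D_der: "D (bracket u v) = bracket (D u) v + bracket u (D v)" for u v
    unfolding D_def by (rule bracket_derivation)
  \<comment> \<open>Expanding \<open>D (D (bracket u v))\<close> by the Leibniz rule leaves only the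
    mixed term, twice. This is the quadratic term in \<open>c\<close> that would obstruct
    \<open>hom\<close>.\<close>
  have DbD: "bracket (D u) (D v) = 0" for u v
  proof -
    have "D (D (bracket u v)) = scale 2 (bracket (D u) (D v))"
      unfolding D_der D_add DD using scale_left_distrib[of 1 1 "bracket (D u) (D v)"] by simp
    then show ?thesis by (simp add: DD)
  qed
  define g where "g u = u + scale c (D u)" for u
  have lin: "Vector_Spaces.linear scale scale g"
    by (rule linear_mapI) (simp_all add: g_def D_add D_scale scale_right_distrib mult.commute)
  have "bij g"
    by (rule o_bij[of "\<lambda>u. u - scale c (D u)"])
      (simp_all add: fun_eq_iff g_def D_add D_diff D_scale DD)
  have hom: "g (bracket u v) = bracket (g u) (g v)" for u v
    by (simp add: g_def D_der DbD bracket_add_left bracket_add_right bracket_scale_left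
        bracket_scale_right scale_right_distrib)
  obtain m2 where m2: "transposed_poisson_algebra scale bracket m2"
      "tp_isomorphic scale bracket m1 scale bracket m2" "\<And>u v. g (m2 u v) = m1 (g u) (g v)"
    using transport_structure[OF m1(1) lin \<open>bij g\<close> hom] by blast
  \<comment> \<open>The new product is again in the family, so comparing three products in a few
    coordinates determines its parameters.\<close>
  obtain A2 B2 C2 G2 where par: "parametrized m2 A2 B2 C2 G2"
    using parametrized_exists[OF m2(1)] by blast
  note t1 = m1(3)[unfolded parametrized_def product_table_def, folded l_def]
  note t2 = par[unfolded parametrized_def product_table_def, folded l_def]
  have "2*n - 1 \<noteq> 2*n" "2 \<noteq> 2*n - 1" "2 \<le> 2*n - 1" "2*n - 1 \<le> 2*n" "2 \<le> 2*n" "2*n \<noteq> 2*n - 1"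
    using n_ge_3 by linarith+
  then have D_simps: "D (e (2*n - 1)) = e (2*n)" "D (e (2*n)) = 0" "D (e 2) = 0"
    by (simp_all only: D_e order_refl if_True if_False simp_thms)
  then have g_last: "g (scale a (e (2*n - 1)) + scale b (e (2*n))) =
      scale a (e (2*n - 1)) + scale (b + c * a) (e (2*n))" for a b
    by (simp add: g_def D_add D_scale scale_left_distrib add.assoc)
  have g_e2: "g (e 2) = e 2" and g_x: "g x = x + scale (c * l) (e 2)"
    by (simp_all add: g_def D_simps D_x)
  have "scale A2 (e (2*n - 1)) + scale (B2 + c * A2) (e (2*n)) =
      scale A (e (2*n - 1)) + scale B (e (2*n))"
    using m2(3)[of "e 2" "e 2"] t1 t2 by (simp add: g_last g_e2)
  then have AB: "A2 = A" "B2 = B - c * A" by (auto simp: last_two_eq_iff)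
  have "g (m2 (e 2) x) = m1 (e 2) x + scale (c * l) (m1 (e 2) (e 2))"
    using m2(3)[of "e 2" x] by (simp add: g_e2 g_x m1.mult_simps)
  then have "coord (2*n) (g (m2 (e 2) x)) = C + c * l * B"
    using t1 by (simp only: coord_add coord_scale coord_last) simp
  moreover have "coord (2*n) (g (m2 (e 2) x)) = C2 - c * l * B2"
    using t2 by (simp only: g_last coord_last_two) simp
  ultimately have "C2 - c * l * B2 = C + c * l * B" by simp
  then have C: "C2 = C'" unfolding C'_def AB by (simp add: algebra_simps power2_eq_square)
  have "g (m2 x x) = m1 x x + scale (c * l) (m1 x (e 2)) + scale (c * l) (m1 (e 2) x) +
      scale (c * l * (c * l)) (m1 (e 2) (e 2))"
    using m2(3)[of x x] by (simp add: g_x m1.mult_simps scale_right_distrib add.assoc)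
  then have "coord (2*n) (g (m2 x x)) = G + c * l * C + c * l * C + c * l * (c * l) * B"
    using t1 by (simp only: coord_add coord_scale coord_last) simp
  moreover have "coord (2*n) (g (m2 x x)) = G2 - c * l * C2"
    using t2 by (simp only: g_last coord_last_two) simp
  ultimately have "G2 - c * l * C2 = G + c * l * C + c * l * C + c * l * (c * l) * B" by simp
  then have "G2 = G + 2 * c * l * C + c\<^sup>2 * l\<^sup>2 * B + c * l * C'"
    unfolding C by (simp add: algebra_simps power2_eq_square)
  then show ?thesis
    unfolding equivalent_structure_def
    using m2(1) tp_isomorphic_trans[OF m1(2) m2(2)] par AB C by blast
qed

text \<open>The torus fixes \<open>x\<close> and scales \<open>e 1\<close> by \<open>s\<close> and
  \<open>e 2\<close> by \<open>t\<close>; the brackets then force the factors \<mu> on the other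
  \<open>e i\<close>. Only \<open>p = s ^ (2n - 3)\<close> and \<open>t\<close> affect the
  parameters, so \<open>s\<close> is taken as a root of \<open>p\<close>.\<close>

lemma equivalent_structure_rescale:
  assumes eq: "equivalent_structure m A B C G" and p: "p \<noteq> 0" and t: "t \<noteq> 0"
  shows "equivalent_structure m (A * t / p) (B / p) (C / (p * t)) (G / (p * t\<^sup>2))"
proof -
  from eq obtain m1 where m1: "transposed_poisson_algebra scale bracket m1"
      "tp_isomorphic scale bracket m scale bracket m1" "parametrized m1 A B C G"
    by (auto simp: equivalent_structure_def)
  interpret m1: transposed_poisson_algebra scale bracket m1 by (rule m1)
  have "2*n - 3 > 0" using n_ge_3 by linarith
  with p obtain s where s: "s ^ (2*n - 3) = p" by (rule complex_root_exists)
  have s0: "s \<noteq> 0" using s p n_ge_3 by auto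
  define \<mu> where "\<mu> i = (if i = 1 then s else if i = 2*n then s ^ (2*n - 3) * t\<^sup>2 else s ^ (i - 2) * t)" for i
  have \<mu>0: "\<mu> i \<noteq> 0" for i using s0 t by (simp add: \<mu>_def)
  have extend: "\<exists>g. Vector_Spaces.linear scale scale g \<and> g x = x \<and>
      (\<forall>i. 1 \<le> i \<longrightarrow> i \<le> 2*n \<longrightarrow> g (e i) = scale (\<nu> i) (e i))" for \<nu>
  proof -
    interpret pair: vector_space_pair scale scale ..
    define f where "f v = (if v = x then x else scale (\<nu> (inv_into {1..2*n} e v)) v)" for v
    obtain g where g: "Vector_Spaces.linear scale scale g" "\<forall>v\<in>insert x (e ` {1..2*n}). g v = f v"
      using pair.linear_independent_extend[OF basis_independent] by blast
    have "f (e i) = scale (\<nu> i) (e i)" if "i \<in> {1..2*n}" for i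
      using that basis_inj inv_into_f_f[OF basis_inj(1) that] by (auto simp: f_def)
    then show ?thesis using g by (intro exI[of _ g]) (auto simp: f_def)
  qed
  obtain g where lin: "Vector_Spaces.linear scale scale g" and gx: "g x = x"
    and ge: "\<And>i. 1 \<le> i \<Longrightarrow> i \<le> 2*n \<Longrightarrow> g (e i) = scale (\<mu> i) (e i)"
    using extend[of \<mu>] by blast
  obtain h where hlin: "Vector_Spaces.linear scale scale h" and hx: "h x = x"
    and he: "\<And>i. 1 \<le> i \<Longrightarrow> i \<le> 2*n \<Longrightarrow> h (e i) = scale (1 / \<mu> i) (e i)"
    using extend[of "\<lambda>i. 1 / \<mu> i"] by blast
  note g = linear_map_simps[OF lin] and h = linear_map_simps[OF hlin]
  have "g (h u) = u" for u
    by (induction u rule: basis_induct) (use n_ge_3 \<mu>0 in \<open>simp_all add: g h gx hx ge he\<close>)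
  moreover have "h (g u) = u" for u
    by (induction u rule: basis_induct) (use n_ge_3 \<mu>0 in \<open>simp_all add: g h gx hx ge he\<close>)
  ultimately have "bij g" by (intro o_bij[of h]) (simp_all add: fun_eq_iff)
  have hom_x: "g (bracket u x) = bracket (g u) (g x)" for u
  proof (induction u rule: basis_induct)
    case (e i)
    then show ?case
      using bracket_e_x_weight[of i] by (simp add: g gx ge bracket_scale_left mult.commute)
  qed (use n_ge_3 in \<open>simp_all add: g gx ge bracket_add_left bracket_scale_left
      bracket_alternating bracket_e1_x\<close>)
  \<comment> \<open>The second argument runs through \<open>x\<close>, \<open>e 1\<close> and the
    remaining \<open>e j\<close> in turn; swapping the arguments reduces pairs to those already
    treated.\<close>
  have hom_antisym: "g (bracket u v) = bracket (g u) (g v)"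
    if "g (bracket v u) = bracket (g v) (g u)" for u v
    using that bracket_antisym[of u v] bracket_antisym[of "g u" "g v"] g(2)[of "-1" "bracket v u"]
    by simp
  have \<mu>_Suc: "\<mu> i * \<mu> 1 = \<mu> (i + 1)" if "2 \<le> i" "i \<le> 2*n - 2" for i
  proof -
    have "i \<noteq> 1" "i \<noteq> 2*n" "i + 1 \<noteq> 2*n" "i + 1 \<noteq> 1" "i + 1 - 2 = Suc (i - 2)"
      using that n_ge_3 by linarith+
    then show ?thesis by (simp add: \<mu>_def)
  qed
  have hom_e1: "g (bracket u (e 1)) = bracket (g u) (g (e 1))" for u
  proof (induction u rule: basis_induct)
    case x
    show ?case by (rule hom_antisym) (rule hom_x)
  next
    case (e i)
    have "1 \<le> 2*n" using n_ge_3 by linarith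
    have "bracket (g (e i)) (g (e 1)) = scale (\<mu> i * \<mu> 1) (bracket (e i) (e 1))"
      using e \<open>1 \<le> 2*n\<close> by (simp add: ge bracket_scale_left bracket_scale_right mult.commute)
    then show ?case
      using e by (simp add: bracket_e_e1_eq ge \<mu>_Suc g)
  qed (simp_all add: g bracket_add_left bracket_scale_left bracket_alternating)
  have \<mu>_pair: "\<mu> i * \<mu> j = \<mu> (2*n)" if "2 \<le> i" "2 \<le> j" "i + j = 2*n + 1" for i j
  proof -
    have "i \<noteq> 1" "i \<noteq> 2*n" "j \<noteq> 2*n" "j \<noteq> 1" "2*n \<noteq> 1" "2*n - 3 = (i - 2) + (j - 2)"
      using that n_ge_3 by linarith+
    then show ?thesis by (simp add: \<mu>_def power_add power2_eq_square)
  qed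
  have hom_e: "g (bracket u (e j)) = bracket (g u) (g (e j))" if j: "2 \<le> j" "j \<le> 2*n" for u j
  proof (induction u rule: basis_induct)
    case x
    show ?case by (rule hom_antisym) (rule hom_x)
  next
    case e1
    show ?case by (rule hom_antisym) (rule hom_e1)
  next
    case (e i)
    have "bracket (g (e i)) (g (e j)) = scale (\<mu> i * \<mu> j) (bracket (e i) (e j))"
      using e j by (simp add: ge bracket_scale_left bracket_scale_right mult.commute)
    then show ?case
      using e j n_ge_3 by (simp add: bracket_e_e_eq ge \<mu>_pair g mult.commute)
  qed (simp_all add: g bracket_add_left bracket_scale_left)
  have hom: "g (bracket u v) = bracket (g u) (g v)" for u v
    by (induction v rule: basis_induct)
      (simp_all add: g bracket_add_right bracket_scale_right hom_x hom_e1 hom_e)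
  obtain m2 where m2: "transposed_poisson_algebra scale bracket m2"
      "tp_isomorphic scale bracket m1 scale bracket m2" "\<And>u v. g (m2 u v) = m1 (g u) (g v)"
    using transport_structure[OF m1(1) lin \<open>bij g\<close> hom] by blast
  obtain A2 B2 C2 G2 where par: "parametrized m2 A2 B2 C2 G2"
    using parametrized_exists[OF m2(1)] by blast
  note t1 = m1(3)[unfolded parametrized_def product_table_def]
  note t2 = par[unfolded parametrized_def product_table_def]
  have \<mu>_vals: "\<mu> 2 = t" "\<mu> (2*n - 1) = p * t" "\<mu> (2*n) = p * t\<^sup>2"
  proof -
    have "(2::nat) \<noteq> 1" "2*n \<noteq> 2" "2*n \<noteq> 1" "2*n - 1 \<noteq> 1" "2*n - 1 \<noteq> 2*n" "2*n - 1 - 2 = 2*n - 3"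
      using n_ge_3 by linarith+
    then show "\<mu> 2 = t" "\<mu> (2*n - 1) = p * t" "\<mu> (2*n) = p * t\<^sup>2"
      unfolding \<mu>_def s by (simp_all add: s)
  qed
  have g_e2: "g (e 2) = scale t (e 2)" using ge[of 2] n_ge_3 by (simp add: \<mu>_vals)
  have "1 \<le> 2*n - 1" "2*n - 1 \<le> 2*n" "1 \<le> 2*n" using n_ge_3 by linarith+
  then have g_last: "g (scale a (e (2*n - 1)) + scale b (e (2*n))) =
      scale (a * (p * t)) (e (2*n - 1)) + scale (b * (p * t\<^sup>2)) (e (2*n))" for a b
    using ge[of "2*n - 1"] ge[of "2*n"] by (simp add: \<mu>_vals g)
  have "g (m2 (e 2) (e 2)) = scale (t * t) (m1 (e 2) (e 2))"
    using m2(3)[of "e 2" "e 2"] by (simp add: g_e2 m1.mult_simps)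
  then have "A2 * (p * t) = t * t * A" "B2 * (p * t\<^sup>2) = t * t * B"
    using t1 t2 by (simp_all add: g_last scale_right_distrib last_two_eq_iff)
  then have AB: "A2 = A * t / p" "B2 = B / p"
    using p t by (simp_all add: field_simps power2_eq_square)
  have "g (m2 (e 2) x) = scale t (m1 (e 2) x)"
    using m2(3)[of "e 2" x] by (simp add: g_e2 gx m1.mult_simps)
  then have "C2 * (p * t\<^sup>2) = t * C"
    using t1 t2 by (simp add: g_last scale_right_distrib last_two_eq_iff)
  then have C: "C2 = C / (p * t)"
    using p t by (simp add: field_simps power2_eq_square)
  have "g (m2 x x) = m1 x x" using m2(3)[of x x] by (simp add: gx)
  then have "G2 * (p * t\<^sup>2) = G"
    using t1 t2 by (simp add: g_last last_two_eq_iff)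
  then have "G2 = G / (p * t\<^sup>2)" using p t by (simp add: field_simps)
  then show ?thesis
    unfolding equivalent_structure_def
    using m2(1) tp_isomorphic_trans[OF m1(2) m2(2)] par AB C by blast
qed

section \<open>Normal forms\<close>

text \<open>If the first nonzero parameter is \<open>A\<close>, \<open>B\<close> or
  \<open>C\<close>, a shift eliminates the parameter after it. The torus then normalises what is
  left; if only \<open>G\<close> is nonzero, it is scaled to 1.\<close>

lemma structure_classification:
  assumes tp: "transposed_poisson_algebra scale bracket m" and nontrivial: "\<not> trivial_product m"
  shows "equivalent_structure m 0 0 0 1 \<or> equivalent_structure m 0 0 1 0 \<or>
    equivalent_structure m 0 1 0 0 \<or> equivalent_structure m 0 1 0 1 \<or>
    equivalent_structure m 1 0 0 0 \<or> equivalent_structure m 1 0 0 1 \<or>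
    (\<exists>\<alpha>. equivalent_structure m 1 0 1 \<alpha>)"
proof -
  define l :: complex where "l = 2 * of_nat n - 3"
  have "(of_nat (2*n) :: complex) \<noteq> of_nat 3" unfolding of_nat_eq_iff by presburger
  then have l0: "l \<noteq> 0" by (simp add: l_def)
  note shift = equivalent_structure_shift[folded l_def]
  note rescale = equivalent_structure_rescale
  obtain A B C G where par: "parametrized m A B C G" using parametrized_exists[OF tp] .
  have "tp_isomorphism scale bracket m scale bracket m (\<lambda>u. u)"
    unfolding tp_isomorphism_def using linear_mapI[of "\<lambda>u. u"] bij_id by (simp add: id_def)
  with tp par have eq: "equivalent_structure m A B C G"
    by (auto simp: equivalent_structure_def tp_isomorphic_def)
  consider "A \<noteq> 0" | "A = 0" "B \<noteq> 0" | "A = 0" "B = 0" "C \<noteq> 0" | "A = 0" "B = 0" "C = 0" by blast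
  then show ?thesis
  proof cases
    case 1
    then obtain C1 G1 where eq1: "equivalent_structure m A 0 C1 G1"
      using shift[OF eq, of "B / A"] by auto
    consider "C1 \<noteq> 0" | "C1 = 0" "G1 = 0" | "C1 = 0" "G1 \<noteq> 0" by blast
    then show ?thesis
    proof cases
      case C1: 1
      \<comment> \<open>With \<open>p = A * t\<close> the first parameter becomes 1 and the third
        \<open>C1 / (A * t\<^sup>2)\<close>. This uses up the torus scaling, so the last parameter
        remains as \<alpha>.\<close>
      define t where "t = csqrt (C1 / A)"
      have t: "t * t = C1 / A" "t \<noteq> 0"
        using C1 1 by (simp_all add: t_def flip: power2_eq_square)
      have "C1 / (A * t * t) = 1" using t(1) C1 1 by (simp add: mult.assoc)
      then show ?thesis using rescale[OF eq1, of "A * t" t] 1 t by auto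
    next
      case 2
      then show ?thesis using rescale[OF eq1, of A 1] 1 by auto
    next
      case G1: 3
      then have "G1 / A \<noteq> 0" using 1 by simp
      \<comment> \<open>With \<open>p = A * t\<close> the last parameter becomes
        \<open>G1 / (A * t ^ 3)\<close>, hence the cube root.\<close>
      then obtain t where t: "t ^ 3 = G1 / A" by (rule complex_root_exists[where k = 3]) simp
      then have "t \<noteq> 0" using G1 1 by auto
      have "A * t * t\<^sup>2 = A * t ^ 3" by (simp add: power2_eq_square power3_eq_cube)
      then have "G1 / (A * t * t\<^sup>2) = 1" using t G1 1 by simp
      then show ?thesis using rescale[OF eq1, of "A * t" t] G1 1 \<open>t \<noteq> 0\<close> by auto
    qed
  next
    case 2
    \<comment> \<open>For \<open>A = 0\<close> the shift by \<open>c\<close> adds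
      \<open>2 * c * l * B\<close> to \<open>C\<close>.\<close>
    have "C + - C / (2 * l * B) * l * (2 * B - - C / (2 * l * B) * A) = 0"
      using 2 l0 by (simp add: field_simps)
    then obtain G1 where eq1: "equivalent_structure m 0 B 0 G1"
      using shift[OF eq, of "- C / (2 * l * B)"] 2 by auto
    show ?thesis
    proof (cases "G1 = 0")
      case True
      then show ?thesis using rescale[OF eq1, of B 1] 2 by auto
    next
      case False
      define t where "t = csqrt (G1 / B)"
      have "t\<^sup>2 = G1 / B" "t \<noteq> 0" using False 2 by (simp_all add: t_def)
      then show ?thesis using rescale[OF eq1, of B t] False 2 by auto
    qed
  next
    case 3
    \<comment> \<open>For \<open>A = B = 0\<close> the shift by \<open>c\<close> fixes
      \<open>C\<close> and adds \<open>3 * c * l * C\<close> to \<open>G\<close>.\<close>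
    have "G + 2 * (- G / (3 * l * C)) * l * C + (- G / (3 * l * C)) * l * C = 0"
      using 3 l0 by (simp add: field_simps)
    then have "equivalent_structure m 0 0 C 0"
      using shift[OF eq, of "- G / (3 * l * C)"] 3 by simp
    from rescale[OF this, of C 1] 3 show ?thesis by auto
  next
    case 4
    then have "G \<noteq> 0" using trivial_if_parametrized_zero[OF tp] par nontrivial by blast
    then show ?thesis using rescale[OF eq, of G 1] 4 by auto
  qed
qed

end

theorem theorem3p7:
  fixes scale :: "complex \<Rightarrow> 'a::ab_group_add \<Rightarrow> 'a"
    and bracket mult :: "'a \<Rightarrow> 'a \<Rightarrow> 'a"
    and n :: nat and e :: "nat \<Rightarrow> 'a" and x :: 'a
  assumes "n \<ge> 3"
    and "r_lie_algebra scale bracket n (2 * of_nat n - 3) e x"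
    and "transposed_poisson_algebra scale bracket mult"
    and "\<not> trivial_product mult"
  shows "\<exists>mult'. transposed_poisson_algebra scale bracket mult' \<and>
    tp_isomorphic scale bracket mult scale bracket mult' \<and>
    (product_table n e x mult' 0 0 (e (2*n)) \<or>
     product_table n e x mult' 0 (e (2*n)) (scale (3 - 2 * of_nat n) (e (2*n - 1))) \<or>
     product_table n e x mult' 0 (e (2*n)) (scale (3 - 2 * of_nat n) (e (2*n - 1)) + e (2*n)) \<or>
     product_table n e x mult' (e (2*n)) (scale (3 - 2 * of_nat n) (e (2*n - 1))) 0 \<or>
     product_table n e x mult' (e (2*n)) (scale (3 - 2 * of_nat n) (e (2*n - 1))) (e (2*n)) \<or>
     (\<exists>\<alpha>. product_table n e x mult' (e (2*n))
        (scale (3 - 2 * of_nat n) (e (2*n - 1)) + e (2*n))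
        (scale (3 - 2 * of_nat n) (e (2*n - 1)) + scale \<alpha> (e (2*n)))) \<or>
     product_table n e x mult' (e (2*n - 1)) 0 0 \<or>
     product_table n e x mult' (e (2*n - 1)) 0 (e (2*n)) \<or>
     (\<exists>\<alpha>. product_table n e x mult' (e (2*n - 1)) (e (2*n))
        (scale (3 - 2 * of_nat n) (e (2*n - 1)) + scale \<alpha> (e (2*n)))) \<or>
     (\<exists>\<alpha> \<beta>. product_table n e x mult' (e (2*n - 1) + e (2*n))
        (scale (3 - 2 * of_nat n) (e (2*n - 1)) + scale \<alpha> (e (2*n)))
        (scale ((3 - 2 * of_nat n) * \<alpha>) (e (2*n - 1)) + scale \<beta> (e (2*n)))))"
proof -
  interpret L: r_lie_algebra_resonant scale bracket n e x
    using assms(1,2) by (intro r_lie_algebra_resonant.intro r_lie_algebra_resonant_axioms.intro)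
  \<comment> \<open>\<open>minus_diff_eq\<close> turns \<open>- (2 * of_nat n - 3)\<close> into
    \<open>3 - 2 * of_nat n\<close>. With the zeros and ones simplified away, each of the seven
    parameter tuples below becomes one disjunct of the goal.\<close>
  note table = L.parametrized_def L.scale_zero_left L.scale_one add_0_left add_0_right
    mult_zero_right mult_1_right minus_diff_eq
  consider "L.equivalent_structure mult 0 0 0 1" | "L.equivalent_structure mult 0 0 1 0"
    | "L.equivalent_structure mult 0 1 0 0" | "L.equivalent_structure mult 0 1 0 1"
    | "L.equivalent_structure mult 1 0 0 0" | "L.equivalent_structure mult 1 0 0 1"
    | \<alpha> where "L.equivalent_structure mult 1 0 1 \<alpha>"
    using L.structure_classification[OF assms(3,4)] by blast
  then show ?thesis
    by cases (unfold L.equivalent_structure_def table, blast+)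
qed

end
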